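(* Define $h\colon\mathbb{R}^n\to\mathbb{R}^p$ by $h(x):=(f_1(x),\ldots,f_p(x))$, where $f_i\colon\mathbb{R}^n\to\mathbb{R}$, $i=1,\ldots,p$, are convex functions. Suppose that $g\colon\mathbb{R}^p\to(-\infty,\infty]$ is convex and nondecreasing componentwise. Then the composition $g\circ h\colon\mathbb{R}^n\to(-\infty,\infty]$ is a convex function, and for every $\bar{x}\in\mathbb{R}^n$ with $\bar{y}:=h(\bar{x})\in\mathrm{dom}(g)$ we have $$\partial(g\circ h)(\bar{x})=\Big\{\sum_{i=1}^p\gamma_iv_i : (\gamma_1,\ldots,\gamma_p)\in\partial g(\bar{y}),\ v_i\in\partial f_i(\bar{x}),\ i=1,\ldots,p\Big\}$$ under the condition that there exist $\bar{u}\in\mathbb{R}^n$ and $\bar\lambda_i>f_i(\bar{u})$ for all $i=1,\ldots,p$ satisfying $$(\bar\lambda_1,\ldots,\bar\lambda_p)\in\mathrm{ri}(\mathrm{dom}(g)).$$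
   Context: A function $g\colon\mathbb{R}^p\to(-\infty,\infty]$ is nondecreasing componentwise if $x_i\le y_i$ for all $i=1,\ldots,p$ implies $g(x_1,\ldots,x_p)\le g(y_1,\ldots,y_p)$. $\mathrm{dom}(g):=\{y : g(y)<\infty\}$. For a convex function $f$ and $\bar{x}\in\mathrm{dom}(f)$, $\partial f(\bar{x}):=\{v : f(x)\ge f(\bar{x})+\langle v,x-\bar{x}\rangle\text{ for all }x\}$. The relative interior $\mathrm{ri}(\Omega)$ of a convex set $\Omega$ is the set of $x\in\Omega$ for which there is $\gamma>0$ with $\mathbb{B}(x;\gamma)\cap\mathrm{aff}(\Omega)\subset\Omega$ (closed ball, affine hull). *)

theory Defs
  imports "HOL-Analysis.Analysis"
begin

(* Functions with values in (-\<infinity>, \<infinity>] are modelled as ereal-valued functions together with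
   the explicit side condition that the value -\<infinity> is never attained; under that condition no
   sum of the form \<infinity> + (-\<infinity>) occurs below. *)

definition never_minf :: "('a \<Rightarrow> ereal) \<Rightarrow> bool" where
  "never_minf g \<longleftrightarrow> (\<forall>x. g x \<noteq> - \<infinity>)"

definition ext_convex :: "('a::real_vector \<Rightarrow> ereal) \<Rightarrow> bool" where
  "ext_convex g \<longleftrightarrow>
     (\<forall>x y. \<forall>t::real. 0 < t \<and> t < 1 \<longrightarrow>
        g (t *\<^sub>R x + (1 - t) *\<^sub>R y) \<le> ereal t * g x + ereal (1 - t) * g y)"

definition eff_dom :: "('a \<Rightarrow> ereal) \<Rightarrow> 'a set" where
  "eff_dom g = {x. g x < \<infinity>}"

(* Only meaningful at points of eff_dom g, which is the only place it is used. *)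

definition subdifferential :: "('a::real_inner \<Rightarrow> ereal) \<Rightarrow> 'a \<Rightarrow> 'a set" where
  "subdifferential g a = {v. \<forall>x. g x \<ge> g a + ereal (v \<bullet> (x - a))}"

end

theory Submission
  imports Defs
begin

text \<open>
  Idea. A subgradient of \<open>g\<close> is a nonnegative vector, because \<open>g\<close> is nondecreasing; combining
  the subgradient inequality of \<open>g\<close> with those of the \<open>f i\<close>, weighted by its components, yields
  the inclusion from right to left.

  For the other inclusion let \<open>w\<close> be a subgradient of \<open>g \<circ> h\<close> at \<open>a\<close>. By monotonicity this
  means that \<open>a\<close> and \<open>h a\<close> solve the convex program of minimising \<open>g y - w \<bullet> x\<close> subject to
  \<open>h x \<le> y\<close>. A Lagrange multiplier \<open>\<gamma>\<close> for the constraint (\<open>composition_multiplier\<close>) satisfies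
  \<open>g y - w \<bullet> x + \<gamma> \<bullet> (h x - y) \<ge> g (h a) - w \<bullet> a\<close> for all \<open>x\<close> and \<open>y\<close>. Putting \<open>x = a\<close> shows that
  \<open>\<gamma>\<close> is a subgradient of \<open>g\<close> at \<open>h a\<close>; putting \<open>y = h a\<close> shows that \<open>w\<close> is a subgradient at \<open>a\<close>
  of the finite convex function \<open>\<Sum>i. \<gamma> $ i * f i\<close>, and the subdifferential sum rule
  (\<open>subgradient_weighted_sum_split\<close>) splits \<open>w\<close>.

  Both the multiplier and the sum rule come from one separation argument
  (\<open>multiplier_exists\<close>): a convex set in a product \<open>E \<times> \<real>\<close> that meets the vertical axis only at
  nonnegative heights lies above a non-vertical hyperplane through the origin, provided the origin
  is interior to its shadow in \<open>E\<close>. For the sum rule the shadow is everything. For the chain rule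
  interiority is what the qualification condition provides: the point \<open>x = u\<close>, \<open>y = l\<close> is strictly
  feasible, so the constraint can be tightened a little in every component.
\<close>

section \<open>Multipliers from separation\<close>

text \<open>
  Separate the origin from the points lying strictly above \<open>C\<close>. The hyperplane cannot be
  vertical, since a vertical one would bound the shadow of \<open>C\<close> on one side of the origin.
\<close>
lemma multiplier_exists:
  fixes C :: "('a::euclidean_space \<times> real) set"
  assumes "convex C"
    and axis: "\<And>r. (0, r) \<in> C \<Longrightarrow> 0 \<le> r"
    and shadow: "0 \<in> interior (fst ` C)"
  obtains c where "\<And>z r. (z, r) \<in> C \<Longrightarrow> 0 \<le> c \<bullet> z + r"
proof -
  define C' where "C' = (\<Union>p\<in>C. \<Union>q\<in>{0::'a} \<times> {0::real<..}. {p + q})"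
  have "convex C'"
    unfolding C'_def
    by (intro convex_sums assms(1) convex_Times convex_singleton convex_real_interval)
  moreover have "0 \<notin> C'"
  proof
    assume "0 \<in> C'"
    then obtain z r t where *: "(z, r) \<in> C" "(0::real) < t" "z = 0" "r + t = 0"
      unfolding C'_def zero_prod_def by auto
    with axis[of r] show False by simp
  qed
  ultimately obtain p where p: "p \<noteq> 0" "\<And>q. q \<in> C' \<Longrightarrow> 0 \<le> p \<bullet> q"
    using separating_hyperplane_set_0[of C'] by auto
  obtain b s where ps: "p = (b, s)" by (cases p)
  have sep: "0 \<le> b \<bullet> z + s * (r + t)" if "(z, r) \<in> C" "0 < t" for z r t
  proof -
    have "(z, r) + (0, t) \<in> C'" unfolding C'_def using that by blast
    from p(2)[OF this] show ?thesis by (simp add: ps)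
  qed
  obtain e where e: "0 < e" "ball 0 e \<subseteq> fst ` C"
    using shadow by (meson mem_interior)
  have "0 \<le> s"
  proof (rule ccontr)
    assume "\<not> 0 \<le> s"
    obtain r where r: "(0, r) \<in> C" using e by (force simp: subset_iff)
    have "0 \<le> s * (r + (\<bar>r\<bar> + 1))" using sep[OF r, of "\<bar>r\<bar> + 1"] by simp
    moreover have "s * (r + (\<bar>r\<bar> + 1)) < 0"
      using \<open>\<not> 0 \<le> s\<close> by (intro mult_neg_pos) auto
    ultimately show False by simp
  qed
  moreover have "s \<noteq> 0"
  proof
    assume "s = 0"
    then have "b \<noteq> 0" using p(1) ps by (auto simp: zero_prod_def)
    define z where "z = - (e / (2 * norm b)) *\<^sub>R b"
    have "norm z = e / 2" using e \<open>b \<noteq> 0\<close> by (simp add: z_def)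
    then have "z \<in> ball 0 e" using e by simp
    then obtain r where "(z, r) \<in> C" using e by force
    from sep[OF this, of 1] have "0 \<le> b \<bullet> z" by (simp add: \<open>s = 0\<close>)
    moreover have "b \<bullet> z < 0" using e \<open>b \<noteq> 0\<close> by (simp add: z_def)
    ultimately show False by simp
  qed
  ultimately have s: "0 < s" by simp
  show thesis
  proof (rule that[of "b /\<^sub>R s"])
    fix z r assume zr: "(z, r) \<in> C"
    show "0 \<le> (b /\<^sub>R s) \<bullet> z + r"
    proof (rule field_le_epsilon)
      fix t :: real assume "0 < t"
      from sep[OF zr this] s show "0 \<le> (b /\<^sub>R s) \<bullet> z + r + t"
        by (simp add: field_simps)
    qed
  qed
qed

section \<open>Subgradients of finite convex functions\<close>

lemma subdifferential_ereal_iff: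
  "v \<in> subdifferential (\<lambda>z. ereal (f z)) a \<longleftrightarrow> (\<forall>x. f a + v \<bullet> (x - a) \<le> f x)"
  by (simp add: subdifferential_def)

text \<open>
  The Moreau--Rockafellar sum rule: decouple the arguments of \<open>F\<close> and \<open>G\<close> and take a multiplier
  for the constraint that they coincide.
\<close>
lemma subgradient_add_split:
  fixes F G :: "'a::euclidean_space \<Rightarrow> real"
  assumes F: "convex_on UNIV F" and G: "convex_on UNIV G"
    and w: "w \<in> subdifferential (\<lambda>x. ereal (F x + G x)) a"
  obtains v where "v \<in> subdifferential (\<lambda>x. ereal (F x)) a"
    and "w - v \<in> subdifferential (\<lambda>x. ereal (G x)) a"
proof -
  let ?H = "\<lambda>x y. F x - F a + G y - G a - w \<bullet> (x - a)"
  define C where "C = {(z, r). \<exists>x y. z = x - y \<and> ?H x y \<le> r}"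
  have "convex C"
  proof (rule convexI)
    fix p q :: "'a \<times> real" and s t :: real
    assume "p \<in> C" "q \<in> C" and st: "0 \<le> s" "0 \<le> t" "s + t = 1"
    then obtain x y r x' y' r' where
      p: "p = (x - y, r)" "?H x y \<le> r" and q: "q = (x' - y', r')" "?H x' y' \<le> r'"
      unfolding C_def by auto
    let ?x = "s *\<^sub>R x + t *\<^sub>R x'" and ?y = "s *\<^sub>R y + t *\<^sub>R y'"
    have t: "t = 1 - s" using st by simp
    have "F ?x \<le> s * F x + t * F x'" "G ?y \<le> s * G y + t * G y'"
      using F G st by (auto simp: convex_on_def)
    then have "?H ?x ?y \<le> s * ?H x y + t * ?H x' y'"
      unfolding t by (simp add: algebra_simps)
    also have "\<dots> \<le> s * r + t * r'"
      using p q st by (intro add_mono mult_left_mono) auto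
    finally show "s *\<^sub>R p + t *\<^sub>R q \<in> C"
      unfolding C_def p q by (auto intro!: exI[of _ ?x] exI[of _ ?y] simp: algebra_simps)
  qed
  moreover have "0 \<le> r" if r: "(0, r) \<in> C" for r
  proof -
    obtain x where "?H x x \<le> r" using r by (auto simp: C_def)
    moreover have "F a + G a + w \<bullet> (x - a) \<le> F x + G x"
      using w by (simp only: subdifferential_ereal_iff)
    ultimately show ?thesis by simp
  qed
  moreover have "fst ` C = UNIV"
  proof -
    have "(z, ?H z 0) \<in> C" for z unfolding C_def by force
    then show ?thesis by (force simp: image_iff)
  qed
  ultimately obtain c where c: "\<And>z r. (z, r) \<in> C \<Longrightarrow> 0 \<le> c \<bullet> z + r"
    using multiplier_exists[of C] by (metis UNIV_I interior_UNIV)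
  have ineq: "0 \<le> c \<bullet> (x - y) + ?H x y" for x y
    by (rule c) (auto simp: C_def)
  show thesis
  proof (rule that[of "w - c"])
    show "w - c \<in> subdifferential (\<lambda>x. ereal (F x)) a"
      unfolding subdifferential_ereal_iff
    proof
      fix x show "F a + (w - c) \<bullet> (x - a) \<le> F x"
        using ineq[of x a] by (simp add: inner_diff_left)
    qed
    show "w - (w - c) \<in> subdifferential (\<lambda>x. ereal (G x)) a"
      unfolding subdifferential_ereal_iff
    proof
      fix x show "G a + (w - (w - c)) \<bullet> (x - a) \<le> G x"
        using ineq[of a x] by (simp add: inner_diff_right)
    qed
  qed
qed

lemma subdifferential_nonempty:
  fixes f :: "'a::euclidean_space \<Rightarrow> real"
  assumes f: "convex_on UNIV f"
  obtains v where "v \<in> subdifferential (\<lambda>x. ereal (f x)) a"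
proof -
  \<comment> \<open>The epigraph of \<open>f\<close>, translated so that its point above \<open>a\<close> becomes the origin.\<close>
  define C where "C = {(z, r). f (a + z) - f a \<le> r}"
  have "C = (+) (- (a, f a)) ` epigraph UNIV f"
  proof (intro set_eqI iffI)
    fix p assume "p \<in> C"
    then have "(a, f a) + p \<in> epigraph UNIV f" by (cases p) (auto simp: C_def epigraph_def)
    then show "p \<in> (+) (- (a, f a)) ` epigraph UNIV f" by (rule rev_image_eqI) (simp add: zero_prod_def)
  qed (auto simp: C_def epigraph_def)
  then have "convex C"
    using f by (simp only: convex_translation_eq convex_epigraph)
  moreover have "0 \<le> r" if "(0, r) \<in> C" for r
    using that by (simp add: C_def)
  moreover have "fst ` C = UNIV"
  proof -
    have "(z, f (a + z) - f a) \<in> C" for z by (simp add: C_def)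
    then show ?thesis by (force simp: image_iff)
  qed
  ultimately obtain c where c: "\<And>z r. (z, r) \<in> C \<Longrightarrow> 0 \<le> c \<bullet> z + r"
    using multiplier_exists[of C] by (metis UNIV_I interior_UNIV)
  have "- c \<in> subdifferential (\<lambda>x. ereal (f x)) a"
    unfolding subdifferential_ereal_iff
  proof
    fix x show "f a + (- c) \<bullet> (x - a) \<le> f x"
      using c[of "x - a" "f x - f a"] by (simp add: C_def)
  qed
  then show thesis by (rule that)
qed

text \<open>
  For \<open>c = 0\<close> the factor \<open>v\<close> is not determined by \<open>w\<close>, and its existence is
  \<open>subdifferential_nonempty\<close>.
\<close>
lemma subgradient_scale_split:
  fixes f :: "'a::euclidean_space \<Rightarrow> real"
  assumes f: "convex_on UNIV f" and c: "0 \<le> c"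
    and w: "w \<in> subdifferential (\<lambda>x. ereal (c * f x)) a"
  obtains v where "v \<in> subdifferential (\<lambda>x. ereal (f x)) a" and "w = c *\<^sub>R v"
proof (cases "c = 0")
  case True
  have "w \<bullet> w \<le> 0"
    using w[unfolded subdifferential_ereal_iff, rule_format, of "a + w"] True by simp
  then have "w = 0" by (metis antisym inner_eq_zero_iff inner_ge_zero)
  then show thesis using subdifferential_nonempty[OF f] True that by (metis scale_zero_left)
next
  case False
  with c have c: "0 < c" by simp
  have "w /\<^sub>R c \<in> subdifferential (\<lambda>x. ereal (f x)) a"
    unfolding subdifferential_ereal_iff
  proof
    fix x
    have "c * f a + w \<bullet> (x - a) \<le> c * f x"
      using w by (simp only: subdifferential_ereal_iff)
    then show "f a + (w /\<^sub>R c) \<bullet> (x - a) \<le> f x"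
      using c by (simp add: field_simps)
  qed
  then show thesis using that[of "w /\<^sub>R c"] c by simp
qed

lemma convex_on_finite_sum:
  fixes f :: "'i \<Rightarrow> 'a::real_vector \<Rightarrow> real"
  assumes "finite I" and "convex S" and "\<And>i. i \<in> I \<Longrightarrow> convex_on S (f i)"
  shows "convex_on S (\<lambda>x. \<Sum>i\<in>I. f i x)"
  using assms by (induction I rule: finite_induct) (auto simp: convex_on_const intro!: convex_on_add)

lemma subgradient_weighted_sum_split:
  fixes f :: "'i \<Rightarrow> 'a::euclidean_space \<Rightarrow> real"
  assumes "finite I" and "\<And>i. i \<in> I \<Longrightarrow> convex_on UNIV (f i)"
    and "\<And>i. i \<in> I \<Longrightarrow> 0 \<le> c i"
    and "w \<in> subdifferential (\<lambda>x. ereal (\<Sum>i\<in>I. c i * f i x)) a"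
  obtains v where "\<And>i. i \<in> I \<Longrightarrow> v i \<in> subdifferential (\<lambda>x. ereal (f i x)) a"
    and "w = (\<Sum>i\<in>I. c i *\<^sub>R v i)"
  using assms
proof (induction I arbitrary: w thesis rule: finite_induct)
  case empty
  have "w \<bullet> w \<le> 0"
    using empty.prems(4)[unfolded subdifferential_ereal_iff, rule_format, of "a + w"] by simp
  then have "w = 0" by (metis antisym inner_eq_zero_iff inner_ge_zero)
  then show ?case using empty.prems(1) by simp
next
  case (insert j I)
  have conv: "convex_on UNIV (\<lambda>x. c i * f i x)" if "i \<in> insert j I" for i
    using insert.prems(2,3) that by (intro convex_on_cmul) auto
  have rest: "convex_on UNIV (\<lambda>x. \<Sum>i\<in>I. c i * f i x)"
    using insert.hyps(1) conv by (intro convex_on_finite_sum) auto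
  have "w \<in> subdifferential (\<lambda>x. ereal (c j * f j x + (\<Sum>i\<in>I. c i * f i x))) a"
    using insert.prems(4) insert.hyps by simp
  then obtain w' where w': "w' \<in> subdifferential (\<lambda>x. ereal (c j * f j x)) a"
    and ww': "w - w' \<in> subdifferential (\<lambda>x. ereal (\<Sum>i\<in>I. c i * f i x)) a"
    using subgradient_add_split[OF conv[of j] rest] by blast
  obtain b where b: "b \<in> subdifferential (\<lambda>x. ereal (f j x)) a" "w' = c j *\<^sub>R b"
    using subgradient_scale_split[OF _ _ w'] insert.prems(2,3) by blast
  obtain v where v: "\<And>i. i \<in> I \<Longrightarrow> v i \<in> subdifferential (\<lambda>x. ereal (f i x)) a"
    "w - w' = (\<Sum>i\<in>I. c i *\<^sub>R v i)"
    using insert.IH[OF _ _ _ ww'] insert.prems(2,3) by blast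
  show ?case
  proof (rule insert.prems(1))
    fix i assume "i \<in> insert j I"
    then show "(v(j := b)) i \<in> subdifferential (\<lambda>x. ereal (f i x)) a"
      using v(1) b(1) by auto
  next
    have "(\<Sum>i\<in>I. c i *\<^sub>R (v(j := b)) i) = (\<Sum>i\<in>I. c i *\<^sub>R v i)"
      using insert.hyps by (intro sum.cong) auto
    then show "w = (\<Sum>i\<in>insert j I. c i *\<^sub>R (v(j := b)) i)"
      using insert.hyps b(2) v(2) by (simp add: algebra_simps)
  qed
qed

section \<open>Nondecreasing convex functions\<close>

text \<open>
  On its domain a function with values in \<open>(-\<infinity>, \<infinity>]\<close> may be replaced by its real part, since
  outside the domain the subgradient inequality is trivial.
\<close>
lemma subdifferential_iff_on_eff_dom:
  assumes "never_minf g" and "a \<in> eff_dom g"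
  shows "v \<in> subdifferential g a \<longleftrightarrow>
    (\<forall>x\<in>eff_dom g. real_of_ereal (g a) + v \<bullet> (x - a) \<le> real_of_ereal (g x))"
proof -
  have real: "ereal (real_of_ereal (g x)) = g x" if "x \<in> eff_dom g" for x
    using that assms(1) by (auto simp: eff_dom_def never_minf_def ereal_real)
  have "g a + ereal (v \<bullet> (x - a)) \<le> g x \<longleftrightarrow>
      (x \<in> eff_dom g \<longrightarrow> real_of_ereal (g a) + v \<bullet> (x - a) \<le> real_of_ereal (g x))" for x
  proof (cases "x \<in> eff_dom g")
    case True
    show ?thesis
      by (subst (1 2) real[symmetric]) (use True assms(2) in auto)
  next
    case False
    then show ?thesis by (simp add: eff_dom_def)
  qed
  then show ?thesis by (auto simp: subdifferential_def)
qed

lemma ext_convex_imp_convex_on_eff_dom: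
  assumes "never_minf g" and "ext_convex g"
  shows "convex_on (eff_dom g) (\<lambda>x. real_of_ereal (g x))"
proof -
  have real: "ereal (real_of_ereal (g x)) = g x" if "x \<in> eff_dom g" for x
    using that assms(1) by (auto simp: eff_dom_def never_minf_def ereal_real)
  have le: "g (t *\<^sub>R x + (1 - t) *\<^sub>R y)
      \<le> ereal (t * real_of_ereal (g x) + (1 - t) * real_of_ereal (g y))"
    if "x \<in> eff_dom g" "y \<in> eff_dom g" "0 < t" "t < 1" for x y and t :: real
  proof -
    have "g (t *\<^sub>R x + (1 - t) *\<^sub>R y) \<le> ereal t * g x + ereal (1 - t) * g y"
      using assms(2) that by (simp add: ext_convex_def)
    also have "\<dots> = ereal t * ereal (real_of_ereal (g x)) + ereal (1 - t) * ereal (real_of_ereal (g y))"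
      using that real by simp
    finally show ?thesis by simp
  qed
  have "convex (eff_dom g)"
    unfolding convex_alt
  proof (intro ballI allI impI)
    fix x y and t :: real
    assume xy: "x \<in> eff_dom g" "y \<in> eff_dom g" and t: "0 \<le> t \<and> t \<le> 1"
    then consider "t = 0" | "t = 1" | "0 < t" "t < 1" by linarith
    then show "(1 - t) *\<^sub>R x + t *\<^sub>R y \<in> eff_dom g"
    proof cases
      case 3
      with le[OF xy(2,1) 3] show ?thesis by (auto simp: eff_dom_def add.commute)
    qed (use xy in auto)
  qed
  then show ?thesis
  proof (rule convex_onI[rotated])
    fix t :: real and x y assume t: "0 < t" "t < 1" and xy: "x \<in> eff_dom g" "y \<in> eff_dom g"
    have z: "(1 - t) *\<^sub>R x + t *\<^sub>R y \<in> eff_dom g"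
      using \<open>convex (eff_dom g)\<close> t xy by (simp add: convex_alt)
    show "real_of_ereal (g ((1 - t) *\<^sub>R x + t *\<^sub>R y))
        \<le> (1 - t) * real_of_ereal (g x) + t * real_of_ereal (g y)"
      using le[OF xy(2,1) t] real[OF z] by (metis add.commute ereal_less_eq(3))
  qed
qed

lemma eff_dom_downward_closed:
  assumes "mono g" and "y \<in> eff_dom g" and "z \<le> y"
  shows "z \<in> eff_dom g"
  using assms monoD[OF assms(1,3)] by (auto simp: eff_dom_def)

text \<open>The subgradient inequality at \<open>b\<close> minus the \<open>i\<close>-th unit vector, where \<open>g\<close> is at most \<open>g b\<close>.\<close>
lemma subgradient_nonneg_of_mono:
  fixes g :: "real ^ 'p \<Rightarrow> ereal"
  assumes "never_minf g" and "mono g" and b: "b \<in> eff_dom g"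
    and c: "c \<in> subdifferential g b"
  shows "0 \<le> c $ i"
proof -
  have le: "b - axis i 1 \<le> b" by (simp add: less_eq_vec_def axis_def)
  have z: "b - axis i 1 \<in> eff_dom g"
    using eff_dom_downward_closed[OF assms(2) b le] .
  have "g (b - axis i 1) \<le> g b" using monoD[OF assms(2) le] .
  then have "real_of_ereal (g (b - axis i 1)) \<le> real_of_ereal (g b)"
    using assms(1) b z by (cases "g b"; cases "g (b - axis i 1)") (auto simp: never_minf_def eff_dom_def)
  moreover have "real_of_ereal (g b) + c \<bullet> (- axis i 1) \<le> real_of_ereal (g (b - axis i 1))"
    using c z subdifferential_iff_on_eff_dom[OF assms(1) b] by fastforce
  ultimately show ?thesis by (simp add: inner_axis)
qed

section \<open>The chain rule\<close>

text \<open>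
  A Lagrange multiplier for minimising \<open>g y - w \<bullet> x\<close> subject to \<open>h x \<le> y\<close>. The set to be
  separated collects the attainable pairs of constraint perturbation and objective value; the
  pair \<open>u\<close>, \<open>l\<close> is Slater's condition.
\<close>
lemma composition_multiplier:
  fixes h :: "'a::euclidean_space \<Rightarrow> real ^ 'p" and g :: "real ^ 'p \<Rightarrow> ereal"
  assumes h_convex: "\<And>i. convex_on UNIV (\<lambda>x. h x $ i)"
    and g: "never_minf g" "ext_convex g" "mono g"
    and slater: "\<And>i. h u $ i < l $ i" "l \<in> eff_dom g"
    and a: "h a \<in> eff_dom g" and w: "w \<in> subdifferential (g \<circ> h) a"
  obtains c where "\<And>x y. y \<in> eff_dom g \<Longrightarrow>
    real_of_ereal (g (h a)) + w \<bullet> (x - a) \<le> real_of_ereal (g y) + c \<bullet> (h x - y)"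
proof -
  let ?D = "eff_dom g" and ?G = "\<lambda>y. real_of_ereal (g y)"
  let ?H = "\<lambda>x y. ?G y - ?G (h a) - w \<bullet> (x - a)"
  have G: "convex_on ?D ?G"
    using g by (intro ext_convex_imp_convex_on_eff_dom)
  define C :: "((real ^ 'p) \<times> real) set"
    where "C = {(z, r). \<exists>x y. y \<in> ?D \<and> h x - y \<le> z \<and> ?H x y \<le> r}"
  have "convex C"
  proof (rule convexI)
    fix p q :: "(real ^ 'p) \<times> real" and s t :: real
    assume "p \<in> C" "q \<in> C" and st: "0 \<le> s" "0 \<le> t" "s + t = 1"
    then obtain x y x' y' where
      p: "y \<in> ?D" "h x - y \<le> fst p" "?H x y \<le> snd p" and
      q: "y' \<in> ?D" "h x' - y' \<le> fst q" "?H x' y' \<le> snd q"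
      unfolding C_def by auto
    let ?x = "s *\<^sub>R x + t *\<^sub>R x'" and ?y = "s *\<^sub>R y + t *\<^sub>R y'"
    have t: "t = 1 - s" using st by simp
    have "convex ?D" using G by (rule convex_on_imp_convex)
    then have y: "?y \<in> ?D" using p q st by (simp add: convex_def)
    have "?G ?y \<le> s * ?G y + t * ?G y'"
      using G p q st by (simp add: convex_on_def)
    then have "?H ?x ?y \<le> s * ?H x y + t * ?H x' y'"
      unfolding t by (simp add: algebra_simps)
    also have "\<dots> \<le> s * snd p + t * snd q"
      using p q st by (intro add_mono mult_left_mono) auto
    finally have r: "?H ?x ?y \<le> s * snd p + t * snd q" .
    have "h ?x - ?y \<le> s *\<^sub>R fst p + t *\<^sub>R fst q"
      unfolding less_eq_vec_def
    proof
      fix i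
      have "h ?x $ i \<le> s * h x $ i + t * h x' $ i"
        using h_convex[of i] st by (simp add: convex_on_def)
      then have "(h ?x - ?y) $ i \<le> s * (h x - y) $ i + t * (h x' - y') $ i"
        by (simp add: algebra_simps)
      also have "\<dots> \<le> s * fst p $ i + t * fst q $ i"
        using p(2) q(2) st unfolding less_eq_vec_def by (intro add_mono mult_left_mono) auto
      finally show "(h ?x - ?y) $ i \<le> (s *\<^sub>R fst p + t *\<^sub>R fst q) $ i" by simp
    qed
    with y r show "s *\<^sub>R p + t *\<^sub>R q \<in> C"
      unfolding C_def by (auto simp: case_prod_unfold)
  qed
  moreover have "0 \<le> r" if r: "(0, r) \<in> C" for r
  proof -
    from r obtain x y where y: "y \<in> ?D" "h x \<le> y" and Hr: "?H x y \<le> r"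
      by (auto simp: C_def)
    have hx: "h x \<in> ?D" using eff_dom_downward_closed[OF g(3) y] .
    have "g (h a) + ereal (w \<bullet> (x - a)) \<le> g (h x)"
      using w by (simp add: subdifferential_def)
    also have "\<dots> \<le> g y" using monoD[OF g(3) y(2)] .
    finally have "?G (h a) + w \<bullet> (x - a) \<le> ?G y"
      using g(1) a y(1) by (cases "g (h a)"; cases "g y") (auto simp: never_minf_def eff_dom_def)
    with Hr show ?thesis by simp
  qed
  moreover have "0 \<in> interior (fst ` C)"
  proof (rule interiorI)
    let ?S = "\<Inter>i. {z. (h u - l) $ i < z $ i}"
    show "open ?S" by (intro open_INT ballI open_halfspace_component_gt_cart) auto
    show "0 \<in> ?S" using slater(1) by simp
    show "?S \<subseteq> fst ` C"
    proof
      fix z assume "z \<in> ?S"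
      then have "h u - l \<le> z" by (auto simp: less_eq_vec_def intro: less_imp_le)
      then have "(z, ?H u l) \<in> C" using slater(2) by (auto simp: C_def)
      then show "z \<in> fst ` C" by force
    qed
  qed
  ultimately obtain c where c: "\<And>z r. (z, r) \<in> C \<Longrightarrow> 0 \<le> c \<bullet> z + r"
    using multiplier_exists by blast
  show thesis
  proof (rule that[of c])
    fix x y assume "y \<in> ?D"
    then have "(h x - y, ?H x y) \<in> C" unfolding C_def by auto
    from c[OF this] show "?G (h a) + w \<bullet> (x - a) \<le> ?G y + c \<bullet> (h x - y)" by simp
  qed
qed

lemma ext_convex_comp:
  fixes h :: "'a::real_vector \<Rightarrow> real ^ 'p"
  assumes h_convex: "\<And>i. convex_on UNIV (\<lambda>x. h x $ i)"
    and "ext_convex g" and "mono g"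
  shows "ext_convex (g \<circ> h)"
  unfolding ext_convex_def
proof (intro allI impI)
  fix x y and t :: real assume t: "0 < t \<and> t < 1"
  have "h (t *\<^sub>R x + (1 - t) *\<^sub>R y) \<le> t *\<^sub>R h x + (1 - t) *\<^sub>R h y"
    using h_convex t by (auto simp: less_eq_vec_def convex_on_def)
  then have "g (h (t *\<^sub>R x + (1 - t) *\<^sub>R y)) \<le> g (t *\<^sub>R h x + (1 - t) *\<^sub>R h y)"
    using \<open>mono g\<close> by (rule monoD[rotated])
  also have "\<dots> \<le> ereal t * g (h x) + ereal (1 - t) * g (h y)"
    using \<open>ext_convex g\<close> t by (simp add: ext_convex_def)
  finally show "(g \<circ> h) (t *\<^sub>R x + (1 - t) *\<^sub>R y)
      \<le> ereal t * (g \<circ> h) x + ereal (1 - t) * (g \<circ> h) y" by simp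
qed

lemma weighted_subgradients_in_subdifferential_comp:
  fixes h :: "'a::real_inner \<Rightarrow> real ^ 'p"
  assumes g: "never_minf g" "mono g" and a: "h a \<in> eff_dom g"
    and c: "c \<in> subdifferential g (h a)"
    and v: "\<And>i. v i \<in> subdifferential (\<lambda>x. ereal (h x $ i)) a"
  shows "(\<Sum>i\<in>UNIV. c $ i *\<^sub>R v i) \<in> subdifferential (g \<circ> h) a"
proof -
  have "g (h a) + ereal ((\<Sum>i\<in>UNIV. c $ i *\<^sub>R v i) \<bullet> (x - a)) \<le> g (h x)" for x
  proof -
    have "(\<Sum>i\<in>UNIV. c $ i *\<^sub>R v i) \<bullet> (x - a) = (\<Sum>i\<in>UNIV. c $ i * (v i \<bullet> (x - a)))"
      by (simp add: inner_sum_left)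
    also have "\<dots> \<le> (\<Sum>i\<in>UNIV. c $ i * (h x - h a) $ i)"
    proof (intro sum_mono mult_left_mono)
      fix i
      show "v i \<bullet> (x - a) \<le> (h x - h a) $ i"
        using v[of i, unfolded subdifferential_ereal_iff, rule_format, of x] by simp
      show "0 \<le> c $ i" using g a c by (rule subgradient_nonneg_of_mono)
    qed
    also have "\<dots> = c \<bullet> (h x - h a)" by (simp add: inner_vec_def)
    finally have "g (h a) + ereal ((\<Sum>i\<in>UNIV. c $ i *\<^sub>R v i) \<bullet> (x - a))
        \<le> g (h a) + ereal (c \<bullet> (h x - h a))"
      by (intro add_left_mono) simp
    also have "\<dots> \<le> g (h x)" using c by (simp add: subdifferential_def)
    finally show ?thesis .
  qed
  then show ?thesis by (simp add: subdifferential_def)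
qed

lemma subdifferential_comp_split:
  fixes h :: "'a::euclidean_space \<Rightarrow> real ^ 'p" and g :: "real ^ 'p \<Rightarrow> ereal"
  assumes h_convex: "\<And>i. convex_on UNIV (\<lambda>x. h x $ i)"
    and g: "never_minf g" "ext_convex g" "mono g"
    and slater: "\<And>i. h u $ i < l $ i" "l \<in> eff_dom g"
    and a: "h a \<in> eff_dom g" and w: "w \<in> subdifferential (g \<circ> h) a"
  obtains c v where "c \<in> subdifferential g (h a)"
    and "\<And>i. v i \<in> subdifferential (\<lambda>x. ereal (h x $ i)) a"
    and "w = (\<Sum>i\<in>UNIV. c $ i *\<^sub>R v i)"
proof -
  obtain c where c: "\<And>x y. y \<in> eff_dom g \<Longrightarrow>
      real_of_ereal (g (h a)) + w \<bullet> (x - a) \<le> real_of_ereal (g y) + c \<bullet> (h x - y)"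
    using composition_multiplier[OF assms] by blast
  have c_sub: "c \<in> subdifferential g (h a)"
    unfolding subdifferential_iff_on_eff_dom[OF g(1) a]
  proof
    fix y assume "y \<in> eff_dom g"
    from c[OF this, of a]
    show "real_of_ereal (g (h a)) + c \<bullet> (y - h a) \<le> real_of_ereal (g y)"
      by (simp add: inner_diff_right)
  qed
  have "w \<in> subdifferential (\<lambda>x. ereal (\<Sum>i\<in>UNIV. c $ i * h x $ i)) a"
    unfolding subdifferential_ereal_iff
  proof
    fix x
    have "(\<Sum>i\<in>UNIV. c $ i * h x $ i) = c \<bullet> h x" for x by (simp add: inner_vec_def)
    then show "(\<Sum>i\<in>UNIV. c $ i * h a $ i) + w \<bullet> (x - a) \<le> (\<Sum>i\<in>UNIV. c $ i * h x $ i)"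
      using c[OF a, of x] by (simp add: inner_diff_right)
  qed
  then obtain v where "\<And>i. v i \<in> subdifferential (\<lambda>x. ereal (h x $ i)) a"
    and "w = (\<Sum>i\<in>UNIV. c $ i *\<^sub>R v i)"
    using subgradient_weighted_sum_split[of UNIV "\<lambda>i x. h x $ i" "\<lambda>i. c $ i" w a]
      h_convex subgradient_nonneg_of_mono[OF g(1,3) a c_sub] by auto
  with c_sub show thesis by (rule that)
qed

theorem theorem9p2:
  fixes f :: "'p::finite \<Rightarrow> real ^ 'n \<Rightarrow> real"
    and h :: "real ^ 'n \<Rightarrow> real ^ 'p"
    and g :: "real ^ 'p \<Rightarrow> ereal"
  assumes h: "h = (\<lambda>x. \<chi> i. f i x)"
    and f_convex: "\<And>i. convex_on UNIV (f i)"
    and g_range: "never_minf g"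
    and g_convex: "ext_convex g"
    and g_mono: "mono g"
  shows "never_minf (g \<circ> h) \<and> ext_convex (g \<circ> h) \<and>
    ((\<exists>u l. (\<forall>i. f i u < l $ i) \<and> l \<in> rel_interior (eff_dom g)) \<longrightarrow>
      (\<forall>x. h x \<in> eff_dom g \<longrightarrow>
        subdifferential (g \<circ> h) x =
          {\<Sum>i\<in>UNIV. \<gamma> $ i *\<^sub>R v i | \<gamma> v.
             \<gamma> \<in> subdifferential g (h x) \<and>
             (\<forall>i. v i \<in> subdifferential (\<lambda>z. ereal (f i z)) x)}))"
proof -
  have f: "f i x = h x $ i" for i x by (simp add: h)
  have h_convex: "convex_on UNIV (\<lambda>x. h x $ i)" for i
    using f_convex[of i] by (simp add: f[symmetric])
  have "never_minf (g \<circ> h)" using g_range by (simp add: never_minf_def)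
  moreover have "ext_convex (g \<circ> h)"
    using h_convex g_convex g_mono by (rule ext_convex_comp)
  moreover have "subdifferential (g \<circ> h) a =
      {\<Sum>i\<in>UNIV. \<gamma> $ i *\<^sub>R v i | \<gamma> v. \<gamma> \<in> subdifferential g (h a) \<and>
        (\<forall>i. v i \<in> subdifferential (\<lambda>z. ereal (f i z)) a)}" (is "?L = ?R")
    if ul: "\<And>i. f i u < l $ i" "l \<in> rel_interior (eff_dom g)" and a: "h a \<in> eff_dom g" for u l a
  proof
    have l: "l \<in> eff_dom g" using ul(2) rel_interior_subset by blast
    show "?L \<subseteq> ?R"
    proof
      fix w assume "w \<in> ?L"
      from subdifferential_comp_split[OF h_convex g_range g_convex g_mono ul(1)[unfolded f] l a this]
      show "w \<in> ?R" unfolding f by blast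
    qed
    show "?R \<subseteq> ?L"
      unfolding f
      by (auto intro!: weighted_subgradients_in_subdifferential_comp[OF g_range g_mono, of h] a)
  qed
  ultimately show ?thesis by blast
qed

end
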